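(* For every integer $n \ge 9$ there exists an $n$-vertex graph $H$ such that $H_3$ is triangle-free, $|E(H_3)| = \left\lfloor \frac{(n-2)^2}{4} \right\rfloor$, and $H_3$ is not isomorphic to $D_3$, where $D$ is the balanced double broom (for distance three) on $n$ vertices.
   Context: All graphs are finite, simple and undirected. For a graph $G$, the $3$-distance graph $G_3$ is the graph on vertex set $V(G)$ in which two vertices are adjacent if and only if their distance in $G$ is exactly $3$. The balanced double broom (for distance three) on $n$ vertices is the tree consisting of two adjacent vertices $x,y$ together with $n-2$ leaves, of which $\lfloor (n-2)/2\rfloor$ are attached to $x$ and $\lceil (n-2)/2\rceil$ are attached to $y$. *)

theory Defs
  imports "HOL-Library.Extended_Nat"
begin

type_synonym 'a graph = "'a set \<times> 'a set set"

abbreviation verts :: "'a graph \<Rightarrow> 'a set" where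
  "verts G \<equiv> fst G"

abbreviation edges :: "'a graph \<Rightarrow> 'a set set" where
  "edges G \<equiv> snd G"

definition simple_graph :: "'a graph \<Rightarrow> bool" where
  "simple_graph G \<longleftrightarrow> finite (verts G) \<and> (\<forall>e \<in> edges G. e \<subseteq> verts G \<and> card e = 2)"

definition adjacent :: "'a graph \<Rightarrow> 'a \<Rightarrow> 'a \<Rightarrow> bool" where
  "adjacent G u v \<longleftrightarrow> {u, v} \<in> edges G"

text \<open>A walk is given by its nonempty list of vertices, so its length is one less than that
  of the list.\<close>

definition walk :: "'a graph \<Rightarrow> 'a \<Rightarrow> 'a list \<Rightarrow> 'a \<Rightarrow> bool" where
  "walk G u p v \<longleftrightarrow> p \<noteq> [] \<and> set p \<subseteq> verts G \<and> hd p = u \<and> last p = v \<and>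
     (\<forall>i. Suc i < length p \<longrightarrow> adjacent G (p ! i) (p ! Suc i))"

text \<open>The infimum of the empty set is \<open>\<infinity>\<close>, which is the distance between vertices in
  different components.\<close>

definition gdist :: "'a graph \<Rightarrow> 'a \<Rightarrow> 'a \<Rightarrow> enat" where
  "gdist G u v = Inf {enat (length p - 1) | p. walk G u p v}"

definition distance3_graph :: "'a graph \<Rightarrow> 'a graph" where
  "distance3_graph G =
     (verts G, {{u, v} | u v. u \<in> verts G \<and> v \<in> verts G \<and> gdist G u v = 3})"

definition triangle_free :: "'a graph \<Rightarrow> bool" where
  "triangle_free G \<longleftrightarrow>
     \<not> (\<exists>u \<in> verts G. \<exists>v \<in> verts G. \<exists>w \<in> verts G.
          u \<noteq> v \<and> v \<noteq> w \<and> u \<noteq> w \<and> adjacent G u v \<and> adjacent G v w \<and> adjacent G u w)"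

definition graph_isomorphic :: "'a graph \<Rightarrow> 'b graph \<Rightarrow> bool" where
  "graph_isomorphic G H \<longleftrightarrow>
     (\<exists>f. bij_betw f (verts G) (verts H) \<and>
        (\<forall>u \<in> verts G. \<forall>v \<in> verts G. adjacent G u v \<longleftrightarrow> adjacent H (f u) (f v)))"

text \<open>The adjacent centres are \<open>x = 0\<close> and \<open>y = 1\<close>; the leaves are \<open>2, \<dots>, n - 1\<close>, the first
  \<open>\<lfloor>(n - 2) / 2\<rfloor>\<close> of which are attached to \<open>x\<close> and the remaining \<open>\<lceil>(n - 2) / 2\<rceil>\<close> to \<open>y\<close>.
  Meaningful for \<open>n \<ge> 2\<close>.\<close>

definition balanced_double_broom :: "nat \<Rightarrow> nat graph" where
  "balanced_double_broom n =
     ({0..<n},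
      {{0, 1}} \<union> {{0, i} | i. i \<in> {2..<2 + (n - 2) div 2}}
               \<union> {{1, i} | i. i \<in> {2 + (n - 2) div 2..<n}})"

end

theory Submission
  imports Defs
begin

text \<open>Move one leaf of the balanced double broom: detach a leaf \<open>a\<close> from the centre \<open>x\<close> and
  hang it on a leaf \<open>b\<close> of the other centre \<open>y\<close>. Among the pairs at distance three this only
  replaces \<open>{a, b}\<close> by \<open>{a, x}\<close>: the path from \<open>a\<close> to any other leaf of \<open>y\<close> now runs through
  \<open>b\<close> and \<open>y\<close>. So the number of such pairs is unchanged and the distance-three graph is still
  bipartite, but only \<open>y\<close> is isolated in it, whereas both centres of the broom are.\<close>

section \<open>Distance three expressed through adjacency\<close>

lemma adjacent_commute: "adjacent G u v \<longleftrightarrow> adjacent G v u"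
  by (simp add: adjacent_def insert_commute)

text \<open>A nonempty set of \<open>enat\<close> values contains its infimum, so a finite distance
  is attained by a walk; without any walk the infimum is \<open>\<infinity>\<close> and no finite
  bound holds.\<close>

lemma gdist_le_iff: "gdist G u v \<le> enat m \<longleftrightarrow> (\<exists>p. walk G u p v \<and> length p \<le> Suc m)"
proof
  assume le: "gdist G u v \<le> enat m"
  let ?S = "{enat (length p - 1) | p. walk G u p v}"
  have "?S \<noteq> {}"
  proof
    assume "?S = {}"
    then have "gdist G u v = \<infinity>" unfolding gdist_def by (simp add: Inf_enat_def)
    with le show False by simp
  qed
  then have "Inf ?S \<in> ?S" by (metis (lifting) ex_in_conv wellorder_InfI)
  then show "\<exists>p. walk G u p v \<and> length p \<le> Suc m"
    using le unfolding gdist_def by fastforce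
next
  assume "\<exists>p. walk G u p v \<and> length p \<le> Suc m"
  then obtain p where p: "walk G u p v" "length p \<le> Suc m" by blast
  have "gdist G u v \<le> enat (length p - 1)"
    unfolding gdist_def by (rule Inf_lower) (use p in blast)
  also have "\<dots> \<le> enat m" using p by simp
  finally show "gdist G u v \<le> enat m" .
qed

lemma walk_Cons:
  "walk G u (w # p) v \<longleftrightarrow>
     w = u \<and> u \<in> verts G \<and> (if p = [] then u = v else \<exists>x. adjacent G u x \<and> walk G x p v)"
proof (cases p)
  case (Cons x q)
  then show ?thesis
    unfolding walk_def by (auto simp: nth_Cons split: nat.splits)
qed (auto simp: walk_def)

lemma walk_Nil: "\<not> walk G u [] v"
  by (simp add: walk_def)

lemma simple_graph_adjacent_verts:
  assumes "simple_graph G" "adjacent G u v"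
  shows "u \<in> verts G" "v \<in> verts G"
  using assms unfolding simple_graph_def adjacent_def by auto

lemma ex_walk_length_Suc:
  "(\<exists>p. walk G u p v \<and> length p \<le> Suc (Suc m)) \<longleftrightarrow>
     u \<in> verts G \<and> (u = v \<or> (\<exists>x. adjacent G u x \<and> (\<exists>p. walk G x p v \<and> length p \<le> Suc m)))"
  (is "?L \<longleftrightarrow> ?R")
proof
  assume ?L
  then obtain p where p: "walk G u p v" "length p \<le> Suc (Suc m)" by blast
  then show ?R by (cases p) (auto simp: walk_Cons walk_Nil split: if_splits)
next
  assume R: ?R
  show ?L
  proof (cases "u = v")
    case True
    then have "walk G u [u] v" using R by (simp add: walk_Cons)
    then show ?thesis by fastforce
  next
    case False
    then obtain x p where x: "adjacent G u x" "walk G x p v" "length p \<le> Suc m" using R by blast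
    then have "walk G u (u # p) v" using R by (auto simp: walk_Cons walk_Nil)
    then show ?thesis using x by (metis Suc_le_mono length_Cons)
  qed
qed

lemma gdist_le_0_iff: "gdist G u v \<le> enat 0 \<longleftrightarrow> u \<in> verts G \<and> u = v"
proof -
  have "walk G u [u] v \<longleftrightarrow> u \<in> verts G \<and> u = v" by (auto simp: walk_Cons)
  moreover have "p = [u]" if "walk G u p v" "length p \<le> Suc 0" for p
    using that by (cases p) (auto simp: walk_Cons walk_Nil)
  ultimately show ?thesis unfolding gdist_le_iff by fastforce
qed

text \<open>Peeling off the first edge of a walk gives a recursion on the bound, so a bound by a
  numeral unfolds to a formula about adjacency alone.\<close>

lemma gdist_le_Suc_iff:
  "gdist G u v \<le> enat (Suc m) \<longleftrightarrow>
     u \<in> verts G \<and> (u = v \<or> (\<exists>x. adjacent G u x \<and> gdist G x v \<le> enat m))"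
  unfolding gdist_le_iff by (rule ex_walk_length_Suc)

lemma gdist_eq_3_iff:
  assumes "simple_graph G"
  shows "gdist G u v = 3 \<longleftrightarrow>
     u \<noteq> v \<and> \<not> adjacent G u v \<and> (\<forall>x. \<not> (adjacent G u x \<and> adjacent G x v)) \<and>
     (\<exists>x y. adjacent G u x \<and> adjacent G x y \<and> adjacent G y v)"
proof -
  have "gdist G u v = 3 \<longleftrightarrow> gdist G u v \<le> enat 3 \<and> \<not> gdist G u v \<le> enat 2"
    by (cases "gdist G u v") (auto simp: numeral_eq_enat)
  then show ?thesis
    unfolding numeral_3_eq_3 numeral_2_eq_2 gdist_le_Suc_iff gdist_le_0_iff
    using simple_graph_adjacent_verts[OF assms] by blast
qed

lemma gdist_eq_3_commute:
  assumes "simple_graph G"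
  shows "gdist G u v = 3 \<longleftrightarrow> gdist G v u = 3"
  unfolding gdist_eq_3_iff[OF assms] by (metis adjacent_commute)

lemma adjacent_distance3_graph:
  assumes "simple_graph G"
  shows "adjacent (distance3_graph G) u v \<longleftrightarrow> gdist G u v = 3"
proof -
  have "u \<in> verts G \<and> v \<in> verts G" if "gdist G u v = 3"
    using that simple_graph_adjacent_verts[OF assms] unfolding gdist_eq_3_iff[OF assms] by blast
  then show ?thesis
    unfolding adjacent_def distance3_graph_def
    using gdist_eq_3_commute[OF assms] by (auto simp: doubleton_eq_iff)
qed

section \<open>Bipartite graphs: absence of triangles and counting of edges\<close>

lemma triangle_free_if_bipartite:
  assumes "\<And>u v. adjacent G u v \<Longrightarrow> u \<in> A \<longleftrightarrow> v \<notin> A"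
  shows "triangle_free G"
  unfolding triangle_free_def using assms by blast

text \<open>Since \<open>A\<close> and \<open>B\<close> are disjoint, an unordered pair determines
  its orientation, so no edge is counted twice.\<close>

lemma card_doubletons:
  assumes "R \<subseteq> A \<times> B" "A \<inter> B = {}"
  shows "card {{u, v} | u v. (u, v) \<in> R} = card R"
proof -
  have "inj_on (\<lambda>(u, v). {u, v}) R"
    by (rule inj_onI) (use assms in \<open>auto simp: doubleton_eq_iff, blast+\<close>)
  moreover have "{{u, v} | u v. (u, v) \<in> R} = (\<lambda>(u, v). {u, v}) ` R"
    by auto
  ultimately show ?thesis by (simp add: card_image)
qed

section \<open>The balanced double broom\<close>

lemma simple_graph_balanced_double_broom:
  assumes "n \<ge> 2"
  shows "simple_graph (balanced_double_broom n)"
  using assms unfolding simple_graph_def balanced_double_broom_def by auto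

lemma adjacent_balanced_double_broom:
  "adjacent (balanced_double_broom n) 0 1"
  "2 \<le> i \<Longrightarrow> i < 2 + (n - 2) div 2 \<Longrightarrow> adjacent (balanced_double_broom n) 0 i"
  "2 + (n - 2) div 2 \<le> i \<Longrightarrow> i < n \<Longrightarrow> adjacent (balanced_double_broom n) 1 i"
  unfolding adjacent_def balanced_double_broom_def by auto

text \<open>Every vertex is a centre or a neighbour of one, and the centres are adjacent, so nothing
  is further than two from a centre.\<close>

lemma balanced_double_broom_centre_isolated:
  assumes "n \<ge> 2" "c \<in> {0, 1}"
  shows "\<not> adjacent (distance3_graph (balanced_double_broom n)) c v"
proof
  let ?D = "balanced_double_broom n"
  note simple = simple_graph_balanced_double_broom[OF assms(1)]
  assume "adjacent (distance3_graph ?D) c v"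
  then have far: "gdist ?D c v = 3" by (simp add: adjacent_distance3_graph[OF simple])
  then obtain y where "adjacent ?D y v" unfolding gdist_eq_3_iff[OF simple] by blast
  then have v: "v < n"
    using simple_graph_adjacent_verts(2)[OF simple] by (fastforce simp: balanced_double_broom_def)
  have "v \<in> {0, 1} \<or> adjacent ?D 0 v \<or> adjacent ?D 1 v"
    using v adjacent_balanced_double_broom(2)[of v n] adjacent_balanced_double_broom(3)[of n v]
    by fastforce
  then show False
    using far assms(2) adjacent_balanced_double_broom(1)[of n] adjacent_commute
    unfolding gdist_eq_3_iff[OF simple] by (metis empty_iff insert_iff)
qed

section \<open>The broom whose leaf \<open>2\<close> is moved from the centre \<open>0\<close> to
  the leaf \<open>2 + k\<close> of the centre \<open>1\<close>\<close>

definition moved_leaf_broom :: "nat \<Rightarrow> nat \<Rightarrow> nat graph" where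
  "moved_leaf_broom n k =
     ({0..<n},
      {{0, 1}, {2, 2 + k}} \<union> {{0, i} | i. i \<in> {3..<2 + k}} \<union> {{1, i} | i. i \<in> {2 + k..<n}})"

lemma simple_graph_moved_leaf_broom:
  assumes "k \<ge> 1" "2 + k < n"
  shows "simple_graph (moved_leaf_broom n k)"
  using assms unfolding simple_graph_def moved_leaf_broom_def by auto

lemma adjacent_moved_leaf_broom_iff:
  "adjacent (moved_leaf_broom n k) i j \<longleftrightarrow>
     i = 0 \<and> (j = 1 \<or> 3 \<le> j \<and> j < 2 + k) \<or> j = 0 \<and> (i = 1 \<or> 3 \<le> i \<and> i < 2 + k) \<or>
     i = 1 \<and> 2 + k \<le> j \<and> j < n \<or> j = 1 \<and> 2 + k \<le> i \<and> i < n \<or>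
     i = 2 \<and> j = 2 + k \<or> j = 2 \<and> i = 2 + k"
  unfolding adjacent_def moved_leaf_broom_def by (auto simp: doubleton_eq_iff)

text \<open>Each pair is listed once, oriented away from the side \<open>{2..<2 + k}\<close>. The
  full product belongs to the unmodified broom; moving the leaf trades \<open>(2, 2 + k)\<close> for
  \<open>(2, 0)\<close>.\<close>

definition moved_leaf_pairs :: "nat \<Rightarrow> nat \<Rightarrow> (nat \<times> nat) set" where
  "moved_leaf_pairs n k = insert (2, 0) ({2..<2 + k} \<times> {2 + k..<n} - {(2, 2 + k)})"

lemma card_moved_leaf_pairs:
  assumes "k \<ge> 1" "2 + k < n"
  shows "card (moved_leaf_pairs n k) = k * (n - 2 - k)"
proof -
  have "(2, 2 + k) \<in> {2..<2 + k} \<times> {2 + k..<n}" using assms by simp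
  then have "card (moved_leaf_pairs n k) = card ({2..<2 + k} \<times> {2 + k..<n})"
    unfolding moved_leaf_pairs_def
    by (subst card_insert_disjoint) (auto simp: card_Suc_Diff1 simp del: card_Diff_insert)
  then show ?thesis by (simp add: card_cartesian_product)
qed

lemma gdist_moved_leaf_broom_eq_3_iff:
  assumes "k \<ge> 2" "3 + k < n"
  shows "gdist (moved_leaf_broom n k) u v = 3 \<longleftrightarrow>
     (u, v) \<in> moved_leaf_pairs n k \<or> (v, u) \<in> moved_leaf_pairs n k" (is "?L \<longleftrightarrow> ?R")
proof -
  let ?H = "moved_leaf_broom n k"
  have simple: "simple_graph ?H" using assms by (simp add: simple_graph_moved_leaf_broom)
  have forward: "gdist ?H a b = 3" if "(a, b) \<in> moved_leaf_pairs n k" for a b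
  proof -
    \<comment> \<open>In every case \<open>a\<close> has exactly one neighbour, so excluding shorter
      walks only requires looking at that neighbour.\<close>
    consider "a = 2" "b = 0" | "a = 2" "2 + k < b" "b < n" | "3 \<le> a" "a < 2 + k" "2 + k \<le> b" "b < n"
      using \<open>(a, b) \<in> _\<close> unfolding moved_leaf_pairs_def by force
    then show ?thesis
    proof cases
      case 1
      have "adjacent ?H 2 x \<longleftrightarrow> x = 2 + k" for x
        using assms by (auto simp: adjacent_moved_leaf_broom_iff)
      moreover have "adjacent ?H (2 + k) 1" "adjacent ?H 1 0" "\<not> adjacent ?H (2 + k) 0"
        using assms by (simp_all add: adjacent_moved_leaf_broom_iff)
      ultimately show ?thesis
        using 1 assms unfolding gdist_eq_3_iff[OF simple] by auto
    next
      case 2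
      have "adjacent ?H 2 x \<longleftrightarrow> x = 2 + k" for x
        using assms by (auto simp: adjacent_moved_leaf_broom_iff)
      moreover have "adjacent ?H (2 + k) 1" "adjacent ?H 1 b" "\<not> adjacent ?H (2 + k) b"
        using 2 assms by (simp_all add: adjacent_moved_leaf_broom_iff)
      ultimately show ?thesis
        using 2 assms unfolding gdist_eq_3_iff[OF simple] by auto
    next
      case 3
      have "adjacent ?H a x \<longleftrightarrow> x = 0" for x
        using 3 assms by (auto simp: adjacent_moved_leaf_broom_iff)
      moreover have "adjacent ?H 0 1" "adjacent ?H 1 b" "\<not> adjacent ?H 0 b"
        using 3 assms by (simp_all add: adjacent_moved_leaf_broom_iff)
      ultimately show ?thesis
        using 3 assms unfolding gdist_eq_3_iff[OF simple] by auto
    qed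
  qed
  show ?thesis
  proof
    assume ?L
    then obtain x y where "u \<noteq> v" "\<not> adjacent ?H u v"
      and far: "\<And>x. \<not> (adjacent ?H u x \<and> adjacent ?H x v)"
      and path: "adjacent ?H u x" "adjacent ?H x y" "adjacent ?H y v"
      unfolding gdist_eq_3_iff[OF simple] by blast
    have v: "u < n" "v < n"
      using simple_graph_adjacent_verts(1)[OF simple path(1)]
        simple_graph_adjacent_verts(2)[OF simple path(3)]
      by (simp_all add: moved_leaf_broom_def)
    \<comment> \<open>A walk of three edges from \<open>2\<close> passes \<open>2 + k\<close> and
      then reaches \<open>1\<close> or returns to \<open>2\<close>. This rules out the leaves of
      \<open>0\<close>, which are at distance four, and the centre \<open>1\<close>.\<close>
    have "x = 2 + k \<and> (y = 1 \<or> y = 2)" if "u = 2"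
      using path(1,2) that assms by (auto simp: adjacent_moved_leaf_broom_iff)
    then have u2: "v = 0 \<or> 2 + k \<le> v" if "u = 2"
      using path(3) that assms by (auto simp: adjacent_moved_leaf_broom_iff)
    have "y = 2 + k \<and> (x = 1 \<or> x = 2)" if "v = 2"
      using path(2,3) that assms by (auto simp: adjacent_moved_leaf_broom_iff)
    then have v2: "u = 0 \<or> 2 + k \<le> u" if "v = 2"
      using path(1) that assms by (auto simp: adjacent_moved_leaf_broom_iff)
    have classes: "w = 0 \<or> w = 1 \<or> w = 2 \<or> (3 \<le> w \<and> w < 2 + k) \<or> (2 + k \<le> w \<and> w < n)"
      if "w < n" for w
      using that by linarith
    show ?R
      \<comment> \<open>Among pairs avoiding \<open>2\<close>, those that are too close are adjacent
        or share one of the centres as a neighbour, so two instances of \<open>far\<close>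
        suffice.\<close>
      using classes[OF v(1)] classes[OF v(2)] u2 v2 \<open>u \<noteq> v\<close> \<open>\<not> adjacent ?H u v\<close>
        far[of 0] far[of 1] assms
      unfolding moved_leaf_pairs_def adjacent_moved_leaf_broom_iff
      by (elim disjE) simp_all
  next
    assume ?R
    then show ?L using forward gdist_eq_3_commute[OF simple] by blast
  qed
qed

section \<open>The edge count and the comparison of isolated vertices\<close>

lemma half_times_half: "m div 2 * (m - m div 2) = m\<^sup>2 div 4" for m :: nat
  by (cases "even m") (auto elim!: evenE oddE simp: power2_eq_square algebra_simps)

theorem mainTheorem3:
  fixes n :: nat
  assumes "n \<ge> 9"
  shows "\<exists>H :: nat graph.
           simple_graph H \<and> card (verts H) = n \<and>
           triangle_free (distance3_graph H) \<and>
           card (edges (distance3_graph H)) = (n - 2)^2 div 4 \<and>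
           \<not> graph_isomorphic (distance3_graph H) (distance3_graph (balanced_double_broom n))"
proof -
  \<comment> \<open>With \<open>k\<close> leaves at \<open>0\<close> before the move, the two sides
    are as equal as possible and \<open>k * (n - 2 - k)\<close> is the required count.\<close>
  define k where "k = (n - 2) div 2"
  have k: "k \<ge> 2" "3 + k < n" using assms unfolding k_def by auto
  let ?H = "moved_leaf_broom n k" and ?R = "moved_leaf_pairs n k"
  let ?D = "balanced_double_broom n"
  have simple: "simple_graph ?H" using k by (simp add: simple_graph_moved_leaf_broom)
  note adj = adjacent_distance3_graph[OF simple] gdist_moved_leaf_broom_eq_3_iff[OF k]
  have verts: "verts ?H = {0..<n}" by (simp add: moved_leaf_broom_def)
  \<comment> \<open>The centre \<open>0\<close> joins the side of the leaves of \<open>1\<close>.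
    This one bipartition gives both triangle-freeness and the edge count.\<close>
  have R: "?R \<subseteq> {2..<2 + k} \<times> insert 0 {2 + k..<n}"
    using k unfolding moved_leaf_pairs_def by auto
  have "triangle_free (distance3_graph ?H)"
    using R by (intro triangle_free_if_bipartite[of _ "{2..<2 + k}"]) (fastforce simp: adj)
  moreover have "edges (distance3_graph ?H) = {{u, v} | u v. (u, v) \<in> ?R}"
  proof -
    have "?R \<subseteq> {0..<n} \<times> {0..<n}" using R k by fastforce
    then show ?thesis
      unfolding distance3_graph_def verts adj(2) snd_conv by (blast intro: insert_commute)
  qed
  then have "card (edges (distance3_graph ?H)) = (n - 2)^2 div 4"
    using card_doubletons[OF R] card_moved_leaf_pairs[of k n] k half_times_half[of "n - 2"]
    by (simp add: k_def)
  moreover have "\<not> graph_isomorphic (distance3_graph ?H) (distance3_graph ?D)"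
  proof
    assume "graph_isomorphic (distance3_graph ?H) (distance3_graph ?D)"
    then obtain f where f: "bij_betw f {0..<n} {0..<n}"
      and iso: "\<And>u v. u < n \<Longrightarrow> v < n \<Longrightarrow>
        adjacent (distance3_graph ?H) u v \<longleftrightarrow> adjacent (distance3_graph ?D) (f u) (f v)"
      unfolding graph_isomorphic_def
      by (auto simp: distance3_graph_def verts balanced_double_broom_def)
    \<comment> \<open>Both centres of the broom are isolated, so their preimages are isolated too;
      only \<open>1\<close> qualifies, yet two distinct preimages are needed.\<close>
    have only: "p = 1" if p: "p < n" "f p \<in> {0, 1}" for p
    proof (rule ccontr)
      assume "p \<noteq> 1"
      have "\<exists>q<n. adjacent (distance3_graph ?H) p q"
        using \<open>p \<noteq> 1\<close> p k unfolding adj moved_leaf_pairs_def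
        \<comment> \<open>The partners avoid the removed pair \<open>(2, 2 + k)\<close>:
          \<open>n - 1\<close> exceeds \<open>2 + k\<close> because \<open>3 + k < n\<close>, and
          \<open>3\<close> lies below \<open>2 + k\<close> because \<open>k \<ge> 2\<close>.\<close>
        by (intro exI[of _ "if p = 0 then 2 else if p < 2 + k then n - 1 else 3"]) auto
      then show False
        using iso p balanced_double_broom_centre_isolated[of n "f p"] assms by auto
    qed
    have "0 \<in> f ` {0..<n}" "1 \<in> f ` {0..<n}" using f k by (auto simp: bij_betw_def)
    then obtain p q where "p < n" "f p = 0" "q < n" "f q = 1" by force
    then show False using only[of p] only[of q] by simp
  qed
  ultimately show ?thesis using simple verts by (intro exI[of _ ?H]) simp
qed

end
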